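(* Let $\mathcal{F}_3$ be the class of all functions $f\in\mathcal{A}$ satisfying $\left|\dfrac{f(z)}{g(z)}-1\right|<1$ $(z\in\mathbb{D})$ for some function $g\in\mathcal{A}$ with $\operatorname{Re}\left(\dfrac{g(z)}{z}\right)>0$ $(z\in\mathbb{D})$. For the class $\mathcal{F}_3$, the following radius results hold: (a) the $\mathcal{S}_{\mathcal{L}}$-radius is $R_{\mathcal{S}_{\mathcal{L}}}=\dfrac{4-2\sqrt2}{\sqrt2\left(\sqrt{17-4\sqrt2}+3\right)}\simeq 0.13009$; (b) the $\mathcal{M}(\beta)$-radius is $R_{\mathcal{M}(\beta)}=\dfrac{2(\beta-1)}{3+\sqrt{9+4\beta(\beta-1)}}$; (c) the $\mathcal{S}^*(\alpha)$-radius is $R_{\mathcal{S}^*(\alpha)}=\dfrac{2(1-\alpha)}{3+\sqrt{9+4(2-\alpha)(1-\alpha)}}$; (d) the $\mathcal{S}_{\mathcal{P}}$-radius is $R_{\mathcal{S}_{\mathcal{P}}}=R_{\mathcal{S}^*(1/2)}=\dfrac{2\sqrt3-3}{3}\simeq 0.154701$. The radii in (c) and (d) are sharp.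
   Context: $\mathbb{D}=\{z\in\mathbb{C}:|z|<1\}$. $\mathcal{A}$ is the class of analytic functions $f$ on $\mathbb{D}$ with $f(0)=0$ and $f'(0)=1$; $\mathcal{S}\subset\mathcal{A}$ is the subclass of univalent functions. Quotients such as $f(z)/g(z)$, $g(z)/z$, $zf'(z)/f(z)$ with $f,g\in\mathcal{A}$ are understood at $z=0$ by their limit value $1$. For $0\le\alpha<1$, $\mathcal{S}^*(\alpha)$ is the class of $f\in\mathcal{S}$ with $\operatorname{Re}(zf'(z)/f(z))>\alpha$ on $\mathbb{D}$ (starlike of order $\alpha$). $\mathcal{S}_{\mathcal{L}}$ is the class of $f\in\mathcal{A}$ with $\left|\left(zf'(z)/f(z)\right)^2-1\right|<1$ on $\mathbb{D}$, that is, $zf'(z)/f(z)$ lies in the region bounded by the right half of the lemniscate of Bernoulli given by $|w^2-1|<1$. For $\beta>1$, $\mathcal{M}(\beta)$ is the class of $f\in\mathcal{A}$ with $\operatorname{Re}(zf'(z)/f(z))<\beta$ on $\mathbb{D}$. $\mathcal{S}_{\mathcal{P}}$ (parabolic starlike functions) is the class of $f\in\mathcal{A}$ with $\operatorname{Re}(zf'(z)/f(z))>\left|zf'(z)/f(z)-1\right|$ on $\mathbb{D}$. For families $\mathcal{G},\mathcal{F}\subset\mathcal{A}$, the $\mathcal{G}$-radius of $\mathcal{F}$, denoted $R_{\mathcal{G}}(\mathcal{F})$ (written $R_{\mathcal{G}}$ when $\mathcal{F}$ is understood; here $\mathcal{F}=\mathcal{F}_3$), is the largest number $R$ such that $r^{-1}f(rz)\in\mathcal{G}$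 for all $0<r\le R$ and all $f\in\mathcal{F}$.
   Formalization: In (a) and (b) the stated numbers are proved only to be admissible (the property holds for all 0 < r ≤ R), not the largest such R; maximality there is false, and sharpness is proved for (c) and (d). *)

theory Defs
  imports "HOL-Complex_Analysis.Complex_Analysis"
begin

abbreviation unit_disc :: "complex set" where
  "unit_disc \<equiv> ball 0 1"

text \<open>
  Analytic functions on the disc are total functions on \<open>complex\<close> that are
  holomorphic on \<open>unit_disc\<close>; their values elsewhere are irrelevant.
\<close>

definition class_A :: "(complex \<Rightarrow> complex) set" where
  "class_A = {f. f holomorphic_on unit_disc \<and> f 0 = 0 \<and> deriv f 0 = 1}"

definition class_S :: "(complex \<Rightarrow> complex) set" where
  "class_S = {f \<in> class_A. inj_on f unit_disc}"

text \<open>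
  Quotient of two functions that both vanish at 0 with the same nonzero derivative there;
  at 0 it takes its limit value 1.
\<close>

definition nquot :: "(complex \<Rightarrow> complex) \<Rightarrow> (complex \<Rightarrow> complex) \<Rightarrow> complex \<Rightarrow> complex" where
  "nquot p q z = (if z = 0 then 1 else p z / q z)"

text \<open>The quotient \<open>z f'(z) / f(z)\<close>.\<close>

definition sl_quot :: "(complex \<Rightarrow> complex) \<Rightarrow> complex \<Rightarrow> complex" where
  "sl_quot f = nquot (\<lambda>z. z * deriv f z) f"

text \<open>
  A condition on \<open>z f'(z) / f(z)\<close> throughout the disc presupposes that the quotient is defined,
  i.e. that \<open>f\<close> has no zero in the disc other than 0. As division by zero yields 0 in HOL,
  this is made explicit.
\<close>

definition zero_free :: "(complex \<Rightarrow> complex) \<Rightarrow> bool" where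
  "zero_free f \<longleftrightarrow> (\<forall>z\<in>unit_disc - {0}. f z \<noteq> 0)"

definition starlike_order :: "real \<Rightarrow> (complex \<Rightarrow> complex) set" where
  "starlike_order \<alpha> = {f \<in> class_S. zero_free f \<and> (\<forall>z\<in>unit_disc. Re (sl_quot f z) > \<alpha>)}"

definition lemniscate_starlike :: "(complex \<Rightarrow> complex) set" where
  "lemniscate_starlike =
     {f \<in> class_A. zero_free f \<and> (\<forall>z\<in>unit_disc. cmod ((sl_quot f z)\<^sup>2 - 1) < 1)}"

definition class_M :: "real \<Rightarrow> (complex \<Rightarrow> complex) set" where
  "class_M \<beta> = {f \<in> class_A. zero_free f \<and> (\<forall>z\<in>unit_disc. Re (sl_quot f z) < \<beta>)}"

definition parabolic_starlike :: "(complex \<Rightarrow> complex) set" where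
  "parabolic_starlike =
     {f \<in> class_A. zero_free f \<and>
        (\<forall>z\<in>unit_disc. Re (sl_quot f z) > cmod (sl_quot f z - 1))}"

definition class_F3 :: "(complex \<Rightarrow> complex) set" where
  "class_F3 =
     {f \<in> class_A. \<exists>g\<in>class_A. (\<forall>z\<in>unit_disc. Re (nquot g (\<lambda>z. z) z) > 0) \<and>
        (\<forall>z\<in>unit_disc. cmod (nquot f g z - 1) < 1)}"

text \<open>
  The bound \<open>R \<le> 1\<close> is needed because, for \<open>r > 1\<close>, the dilation \<open>z \<mapsto> f (r z) / r\<close>
  would evaluate \<open>f\<close> outside the disc.
\<close>

definition admissible_radius ::
  "(complex \<Rightarrow> complex) set \<Rightarrow> (complex \<Rightarrow> complex) set \<Rightarrow> real \<Rightarrow> bool" where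
  "admissible_radius \<G> \<F> R \<longleftrightarrow> 0 < R \<and> R \<le> 1 \<and>
     (\<forall>r. 0 < r \<and> r \<le> R \<longrightarrow> (\<forall>f\<in>\<F>. (\<lambda>z. f (of_real r * z) / of_real r) \<in> \<G>))"

text \<open>\<open>R\<close> is the (sharp) \<open>\<G>\<close>-radius of \<open>\<F>\<close>: the largest admissible number.\<close>

definition is_radius ::
  "(complex \<Rightarrow> complex) set \<Rightarrow> (complex \<Rightarrow> complex) set \<Rightarrow> real \<Rightarrow> bool" where
  "is_radius \<G> \<F> R \<longleftrightarrow> admissible_radius \<G> \<F> R \<and> (\<forall>R'. admissible_radius \<G> \<F> R' \<longrightarrow> R' \<le> R)"

end

theory Submission
  imports Defs
begin

text \<open>
  All four radii come from one sharp disc of values. A function \<open>f\<close> of the class factors as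
  \<open>f(z) = z p(z) h(z)\<close>, where \<open>p(z) = g(z)/z\<close> has positive real part and \<open>h = f/g\<close>
  satisfies \<open>h(0) = 1\<close> and \<open>|h - 1| < 1\<close>. Hence
  \<open>z f'(z)/f(z) - 1 = z p'(z)/p(z) + z h'(z)/h(z)\<close>. The Schwarz--Pick inequality, applied to
  \<open>(p - 1)/(p + 1)\<close> and to \<open>h - 1\<close>, bounds the two terms on \<open>|z| = r\<close> by \<open>2r/(1 - r\<^sup>2)\<close>
  and \<open>r/(1 - r)\<close>, so that
  \<open>|z f'(z)/f(z) - 1| \<le> (3r + r\<^sup>2)/(1 - r\<^sup>2)\<close> (\<open>class_F3_sl_quot_bound\<close>).

  The right-hand side increases with \<open>r\<close> and reaches a prescribed \<open>c > 0\<close> at the positive root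
  \<open>disc_radius c\<close> of \<open>(1 + c) r\<^sup>2 + 3 r = c\<close>. A class that contains every function with
  \<open>|z f'/f - 1| < c\<close> therefore admits the radius \<open>disc_radius c\<close>
  (\<open>admissible_disc_radius\<close>). The largest disc around 1 inside the respective region has radius
  \<open>c = \<surd>2 - 1\<close> for the lemniscate, \<open>\<beta> - 1\<close> and \<open>1 - \<alpha>\<close> for the half planes, and \<open>1/2\<close> for
  the parabola.

  The function \<open>z (1 + z)\<^sup>2 / (1 - z)\<close> makes both estimates equalities on the negative axis, so
  there \<open>z f'/f\<close> takes the value \<open>1 - c\<close> at \<open>-disc_radius c\<close>. For the starlike and the
  parabolic class \<open>1 - c\<close> is a boundary point of the region, which gives sharpness
  (\<open>disc_radius_sharp\<close>).

  Starlikeness of order \<open>\<alpha>\<close> also demands univalence. Writing \<open>f(z) = z exp(k(z))\<close> and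
  \<open>z = exp(u)\<close> turns \<open>log f\<close> into \<open>L(u) = u + k(exp u)\<close> on a half plane, with derivative
  \<open>z f'/f\<close>. A function whose derivative has positive real part on a convex set is injective
  (\<open>inj_on_if_Re_deriv_pos\<close>), and this descends from \<open>L\<close> to \<open>f\<close>
  (\<open>starlike_imp_univalent\<close>).
\<close>

section \<open>Schwarz--Pick estimates for logarithmic derivatives\<close>

text \<open>
  Moebius maps of the disc that send 0 to \<open>a\<close> and \<open>w a\<close> to 0 reduce the claim to the bound
  \<open>|F'(0)| \<le> 1\<close> of the Schwarz lemma; the factors in the statement are the derivatives of the two maps.
\<close>
lemma Schwarz_Pick_deriv:
  assumes hol: "w holomorphic_on unit_disc"
    and bound: "\<And>z. z \<in> unit_disc \<Longrightarrow> cmod (w z) < 1"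
    and a: "a \<in> unit_disc"
  shows "cmod (deriv w a) * (1 - (cmod a)\<^sup>2) \<le> 1 - (cmod (w a))\<^sup>2"
proof -
  define b where "b = w a"
  define \<phi> where "\<phi> = Moebius_function 0 (- a)"
  define \<psi> where "\<psi> = Moebius_function 0 b"
  define F where "F = (\<lambda>\<zeta>. \<psi> (w (\<phi> \<zeta>)))"
  have a1: "cmod a < 1" and b1: "cmod b < 1"
    using a bound by (auto simp: b_def)
  have nz: "1 - cnj b * b \<noteq> 0"
    using b1 by (metis complex_mod_cnj less_irrefl norm_mult_less norm_one mult_1 right_minus_eq)
  have bb: "1 - cnj b * b = of_real (1 - (cmod b)\<^sup>2)"
    by (metis complex_norm_square mult.commute of_real_1 of_real_diff)
  have aa: "1 - a * cnj a = of_real (1 - (cmod a)\<^sup>2)"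
    by (metis complex_norm_square of_real_1 of_real_diff)
  have \<phi>0: "\<phi> 0 = a" and \<psi>b: "\<psi> b = 0"
    by (simp_all add: \<phi>_def \<psi>_def Moebius_function_simple)
  have hol\<phi>: "\<phi> holomorphic_on unit_disc" and hol\<psi>: "\<psi> holomorphic_on unit_disc"
    using a1 b1 by (simp_all add: \<phi>_def \<psi>_def Moebius_function_holomorphic)
  have im\<phi>: "cmod (\<phi> z) < 1" and im\<psi>: "cmod (\<psi> z) < 1" if "cmod z < 1" for z
    using that a1 b1 by (simp_all add: \<phi>_def \<psi>_def Moebius_function_norm_lt_1)
  have d\<phi>: "(\<phi> has_field_derivative (1 - a * cnj a)) (at 0)"
    unfolding \<phi>_def Moebius_function_simple
    by (auto intro!: derivative_eq_intros simp: field_simps)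
  have d\<psi>: "(\<psi> has_field_derivative (1 / (1 - cnj b * b))) (at b)"
    unfolding \<psi>_def Moebius_function_simple
    using nz by (auto intro!: derivative_eq_intros simp: divide_simps)
  have dw: "(w has_field_derivative deriv w a) (at a)"
    using hol a holomorphic_derivI by blast
  have "(F has_field_derivative 1 / (1 - cnj b * b) * (deriv w a * (1 - a * cnj a))) (at 0)"
    unfolding F_def using d\<phi> dw d\<psi> \<phi>0
    by (intro DERIV_chain2[where f = \<psi>] DERIV_chain2[where f = w]) (auto simp: b_def)
  then have dF: "deriv F 0 = deriv w a * of_real (1 - (cmod a)\<^sup>2) / of_real (1 - (cmod b)\<^sup>2)"
    using DERIV_imp_deriv aa bb by fastforce
  have "(w \<circ> \<phi>) holomorphic_on unit_disc"
    by (rule holomorphic_on_compose_gen[OF hol\<phi> hol]) (use im\<phi> in auto)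
  then have "(\<psi> \<circ> (w \<circ> \<phi>)) holomorphic_on unit_disc"
    by (rule holomorphic_on_compose_gen[OF _ hol\<psi>]) (use im\<phi> bound in auto)
  then have holF: "F holomorphic_on unit_disc"
    by (simp add: F_def o_def)
  have F1: "cmod (F z) < 1" if "cmod z < 1" for z
    using that im\<phi> im\<psi> bound by (simp add: F_def)
  have F0: "F 0 = 0"
    using \<phi>0 \<psi>b by (simp add: F_def b_def)
  have "cmod (deriv F 0) \<le> 1"
    by (rule Schwarz_Lemma(2)[OF holF F0 F1, of 0]) auto
  moreover have "0 < 1 - (cmod b)\<^sup>2" "0 < 1 - (cmod a)\<^sup>2"
    using a1 b1 by (simp_all add: power_less_one_iff abs_square_less_1)
  ultimately show ?thesis
    unfolding dF norm_divide norm_mult norm_of_real by (simp add: b_def divide_simps split: if_splits)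
qed

text \<open>
  The Cayley transform \<open>(p - 1)/(p + 1)\<close> maps the right half plane to the disc. In terms of \<open>p\<close>,
  Schwarz--Pick reads \<open>|p'| (1 - |z|\<^sup>2) \<le> 2 Re p\<close>, and \<open>Re p \<le> |p|\<close>.
\<close>
lemma positive_real_part_log_deriv_bound:
  assumes hol: "p holomorphic_on unit_disc"
    and pos: "\<And>z. z \<in> unit_disc \<Longrightarrow> Re (p z) > 0"
    and z: "z \<in> unit_disc"
  shows "cmod (deriv p z / p z) \<le> 2 / (1 - (cmod z)\<^sup>2)"
proof -
  define w where "w = (\<lambda>z. (p z - 1) / (p z + 1))"
  have nz: "p z + 1 \<noteq> 0" if "z \<in> unit_disc" for z
    using pos[OF that] by (auto simp: complex_eq_iff)
  have id: "(cmod (q + 1))\<^sup>2 - (cmod (q - 1))\<^sup>2 = 4 * Re q" for q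
    unfolding cmod_power2 by (simp add: power2_eq_square algebra_simps)
  have "cmod (p z - 1) < cmod (p z + 1)" if "z \<in> unit_disc" for z
    using pos[OF that] id[of "p z"] by (rule_tac power2_less_imp_less) auto
  then have w1: "cmod (w z) < 1" if "z \<in> unit_disc" for z
    using that nz[OF that] by (simp add: w_def norm_divide divide_simps)
  have holw: "w holomorphic_on unit_disc"
    unfolding w_def using nz by (intro holomorphic_intros hol)
  have dp: "(p has_field_derivative deriv p z) (at z)"
    using hol z holomorphic_derivI by blast
  have "(w has_field_derivative 2 * deriv p z / (p z + 1)\<^sup>2) (at z)"
    unfolding w_def using nz[OF z]
    by (auto intro!: derivative_eq_intros dp simp: power2_eq_square algebra_simps)
  then have "deriv w z = 2 * deriv p z / (p z + 1)\<^sup>2"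
    by (rule DERIV_imp_deriv)
  then have "2 * cmod (deriv p z) / (cmod (p z + 1))\<^sup>2 * (1 - (cmod z)\<^sup>2)
      \<le> 1 - (cmod (p z - 1))\<^sup>2 / (cmod (p z + 1))\<^sup>2"
    using Schwarz_Pick_deriv[OF holw w1 z]
    by (simp add: w_def norm_divide norm_mult norm_power power_divide)
  then have "2 * cmod (deriv p z) * (1 - (cmod z)\<^sup>2) \<le> 4 * Re (p z)"
    using nz[OF z] id[of "p z"] by (simp add: divide_simps split: if_splits)
  then have "cmod (deriv p z) * (1 - (cmod z)\<^sup>2) \<le> 2 * cmod (p z)"
    using complex_Re_le_cmod[of "p z"] by linarith
  moreover have "0 < 1 - (cmod z)\<^sup>2" "0 < cmod (p z)"
    using z pos[OF z] by (auto simp: abs_square_less_1)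
  ultimately show ?thesis
    by (simp add: norm_divide divide_simps)
qed

text \<open>
  For \<open>w = h - 1\<close>, Schwarz--Pick bounds \<open>|h'| (1 - |z|\<^sup>2)\<close> by \<open>(1 - |w|)(1 + |w|)\<close>. The first factor
  is at most \<open>|h|\<close>; the Schwarz lemma bounds the second by \<open>1 + |z|\<close>, which cancels.
\<close>
lemma near_one_log_deriv_bound:
  assumes hol: "h holomorphic_on unit_disc" and h0: "h 0 = 1"
    and near: "\<And>z. z \<in> unit_disc \<Longrightarrow> cmod (h z - 1) < 1"
    and z: "z \<in> unit_disc"
  shows "cmod (deriv h z / h z) \<le> 1 / (1 - cmod z)"
proof -
  define w where "w = (\<lambda>z. h z - 1)"
  have holw: "w holomorphic_on unit_disc"
    unfolding w_def by (intro holomorphic_intros hol)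
  have w1: "cmod (w z) < 1" if "z \<in> unit_disc" for z
    using near that by (simp add: w_def)
  have dh: "(h has_field_derivative deriv h z) (at z)"
    using hol z holomorphic_derivI by blast
  have "(w has_field_derivative deriv h z) (at z)"
    unfolding w_def by (auto intro!: derivative_eq_intros dh)
  then have dw: "deriv w z = deriv h z"
    by (rule DERIV_imp_deriv)
  have wz: "cmod (w z) \<le> cmod z"
    by (rule Schwarz_Lemma(1)[OF holw]) (use w1 z h0 in \<open>auto simp: w_def\<close>)
  have hz: "1 - cmod (w z) \<le> cmod (h z)"
    using norm_triangle_ineq2[of 1 "1 - h z"] by (simp add: w_def norm_minus_commute)
  have "cmod (deriv h z) * (1 - (cmod z)\<^sup>2) \<le> (1 - cmod (w z)) * (1 + cmod (w z))"
    using Schwarz_Pick_deriv[OF holw w1 z] dw by (simp add: power2_eq_square algebra_simps)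
  also have "\<dots> \<le> cmod (h z) * (1 + cmod z)"
    using hz wz w1[OF z] by (intro mult_mono) auto
  finally have "(cmod (deriv h z) * (1 - cmod z)) * (1 + cmod z) \<le> cmod (h z) * (1 + cmod z)"
    by (simp add: power2_eq_square algebra_simps)
  then have "cmod (deriv h z) * (1 - cmod z) \<le> cmod (h z)"
    by (rule mult_right_le_imp_le) (simp add: add_pos_nonneg)
  moreover have "cmod (h z) > 0" "cmod z < 1"
    using hz w1[OF z] z by auto
  ultimately show ?thesis
    by (simp add: norm_divide divide_simps)
qed

section \<open>Removable singularities and products\<close>

lemma nquot_id_holomorphic:
  assumes "f \<in> class_A"
  shows "nquot f (\<lambda>z. z) holomorphic_on unit_disc"
proof -
  have "nquot f (\<lambda>z. z) = (\<lambda>z. if z = 0 then deriv f 0 else (f z - f 0) / (z - 0))"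
    using assms by (auto simp: nquot_def class_A_def)
  moreover have "\<dots> holomorphic_on unit_disc"
    using assms by (intro pole_lemma_open) (auto simp: class_A_def)
  ultimately show ?thesis by simp
qed

lemma sl_quot_product:
  assumes "z \<in> unit_disc" "p holomorphic_on unit_disc" "h holomorphic_on unit_disc"
    and "p z \<noteq> 0" "h z \<noteq> 0"
    and f: "\<And>\<zeta>. \<zeta> \<in> unit_disc \<Longrightarrow> f \<zeta> = \<zeta> * p \<zeta> * h \<zeta>"
  shows "sl_quot f z = 1 + z * (deriv p z / p z) + z * (deriv h z / h z)"
proof (cases "z = 0")
  case False
  have "(p has_field_derivative deriv p z) (at z)" "(h has_field_derivative deriv h z) (at z)"
    using assms holomorphic_derivI by blast+
  then have "((\<lambda>\<zeta>. \<zeta> * p \<zeta> * h \<zeta>) has_field_derivative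
      p z * h z + z * deriv p z * h z + z * p z * deriv h z) (at z)"
    by (auto intro!: derivative_eq_intros simp: algebra_simps)
  then have "(f has_field_derivative
      p z * h z + z * deriv p z * h z + z * p z * deriv h z) (at z)"
    by (rule has_field_derivative_transform_within_open[where S = unit_disc]) (use assms in auto)
  then have "deriv f z = p z * h z + z * deriv p z * h z + z * p z * deriv h z"
    by (rule DERIV_imp_deriv)
  with False assms show ?thesis
    by (simp add: sl_quot_def nquot_def field_simps)
qed (simp add: sl_quot_def nquot_def)

section \<open>A disc of values of z f'(z) / f(z)\<close>

text \<open>
  Both quotients have removable singularities at 0. The factor \<open>h = f/g\<close> is holomorphic as the
  quotient of \<open>f(z)/z\<close> by \<open>g(z)/z\<close>, whose real part is positive.
\<close>
lemma class_F3_factorization: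
  assumes "f \<in> class_F3"
  obtains p h where "p holomorphic_on unit_disc" "h holomorphic_on unit_disc" "h 0 = 1"
    "\<And>z. z \<in> unit_disc \<Longrightarrow> Re (p z) > 0"
    "\<And>z. z \<in> unit_disc \<Longrightarrow> cmod (h z - 1) < 1"
    "\<And>z. z \<in> unit_disc \<Longrightarrow> f z = z * p z * h z"
proof -
  from assms obtain g where f: "f \<in> class_A" and g: "g \<in> class_A"
    and pos: "\<And>z. z \<in> unit_disc \<Longrightarrow> Re (nquot g (\<lambda>z. z) z) > 0"
    and near: "\<And>z. z \<in> unit_disc \<Longrightarrow> cmod (nquot f g z - 1) < 1"
    unfolding class_F3_def by blast
  have nz: "nquot g (\<lambda>z. z) z \<noteq> 0" if "z \<in> unit_disc" for z
    using pos[OF that] by auto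
  have "(\<lambda>z. nquot f (\<lambda>z. z) z / nquot g (\<lambda>z. z) z) holomorphic_on unit_disc"
    using nz by (intro holomorphic_on_divide nquot_id_holomorphic f g)
  moreover have "(\<lambda>z. nquot f (\<lambda>z. z) z / nquot g (\<lambda>z. z) z) = nquot f g"
    by (auto simp: nquot_def)
  ultimately have "nquot f g holomorphic_on unit_disc" by simp
  moreover have "f z = z * nquot g (\<lambda>z. z) z * nquot f g z" if "z \<in> unit_disc" for z
    using nz[OF that] f by (auto simp: nquot_def class_A_def split: if_splits)
  ultimately show ?thesis
    using that[OF nquot_id_holomorphic[OF g]] pos near by (simp add: nquot_def)
qed

lemma class_F3_sl_quot_bound:
  assumes f: "f \<in> class_F3" and z: "z \<in> unit_disc"
  shows "cmod (sl_quot f z - 1) \<le> (3 * cmod z + (cmod z)\<^sup>2) / (1 - (cmod z)\<^sup>2)"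
proof -
  obtain p h where hol: "p holomorphic_on unit_disc" "h holomorphic_on unit_disc" and h0: "h 0 = 1"
    and pos: "\<And>z. z \<in> unit_disc \<Longrightarrow> Re (p z) > 0"
    and near: "\<And>z. z \<in> unit_disc \<Longrightarrow> cmod (h z - 1) < 1"
    and eq: "\<And>z. z \<in> unit_disc \<Longrightarrow> f z = z * p z * h z"
    using class_F3_factorization[OF f] by blast
  have "p z \<noteq> 0" "h z \<noteq> 0"
    using pos[OF z] near[OF z] by auto
  then have "sl_quot f z - 1 = z * (deriv p z / p z) + z * (deriv h z / h z)"
    using sl_quot_product[OF z hol _ _ eq] by simp
  then have "cmod (sl_quot f z - 1)
      \<le> cmod z * cmod (deriv p z / p z) + cmod z * cmod (deriv h z / h z)"
    using norm_triangle_ineq by (metis norm_mult)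
  also have "\<dots> \<le> cmod z * (2 / (1 - (cmod z)\<^sup>2)) + cmod z * (1 / (1 - cmod z))"
    by (intro add_mono mult_left_mono positive_real_part_log_deriv_bound
        near_one_log_deriv_bound hol pos near h0 z) auto
  also have "\<dots> = (3 * cmod z + (cmod z)\<^sup>2) / (1 - (cmod z)\<^sup>2)"
  proof -
    have "1 - (cmod z)\<^sup>2 = (1 - cmod z) * (1 + cmod z)"
      by (simp add: power2_eq_square algebra_simps)
    moreover have "1 - cmod z \<noteq> 0" "1 + cmod z \<noteq> 0"
      using z norm_ge_zero[of z] by (simp, linarith)
    ultimately show ?thesis
      by (simp add: divide_simps) (simp add: power2_eq_square algebra_simps)
  qed
  finally show ?thesis .
qed

lemma class_F3_zero_free:
  assumes f: "f \<in> class_F3"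
  shows "zero_free f"
proof -
  obtain p h where pos: "\<And>z. z \<in> unit_disc \<Longrightarrow> Re (p z) > 0"
    and near: "\<And>z. z \<in> unit_disc \<Longrightarrow> cmod (h z - 1) < 1"
    and eq: "\<And>z. z \<in> unit_disc \<Longrightarrow> f z = z * p z * h z"
    by (rule class_F3_factorization[OF f], rule that)
  show ?thesis
    unfolding zero_free_def
  proof
    fix z assume z: "z \<in> unit_disc - {0}"
    then have "p z \<noteq> 0" "h z \<noteq> 0"
      using pos[of z] near[of z] by auto
    then show "f z \<noteq> 0"
      using z eq by auto
  qed
qed

section \<open>Starlike functions are univalent\<close>

text \<open>
  The Noshiro--Warschawski argument: along the segment from \<open>a\<close> to \<open>b\<close>, the real part of
  \<open>L / (b - a)\<close> has derivative \<open>Re L' > 0\<close>, so it is strictly increasing.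
\<close>
lemma inj_on_if_Re_deriv_pos:
  assumes S: "convex S"
    and der: "\<And>u. u \<in> S \<Longrightarrow> (L has_field_derivative L' u) (at u)"
    and pos: "\<And>u. u \<in> S \<Longrightarrow> Re (L' u) > 0"
  shows "inj_on L S"
proof (rule inj_onI, rule ccontr)
  fix a b assume a: "a \<in> S" and b: "b \<in> S" and eq: "L a = L b" and ne: "a \<noteq> b"
  define G where "G = (\<lambda>t::real. Re (L (a + of_real t * (b - a)) / (b - a)))"
  have "G 0 < G 1"
  proof (rule DERIV_pos_imp_increasing[where f = G])
    fix t :: real assume t: "0 \<le> t" "t \<le> 1"
    define u where "u = a + of_real t * (b - a)"
    have u: "u \<in> S"
    proof -
      have "u = (1 - t) *\<^sub>R a + t *\<^sub>R b"
        by (simp add: u_def scaleR_conv_of_real algebra_simps)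
      then show ?thesis
        using convexD[OF S a b, of "1 - t" t] t by simp
    qed
    have "((\<lambda>t. a + of_real t * (b - a)) has_vector_derivative (b - a)) (at t)"
      by (auto intro!: derivative_eq_intros)
    moreover have "(L has_field_derivative L' u) (at (a + of_real t * (b - a)))"
      using der[OF u] by (simp add: u_def)
    ultimately have "((L \<circ> (\<lambda>t. a + of_real t * (b - a))) has_vector_derivative (b - a) * L' u) (at t)"
      by (rule field_vector_diff_chain_at)
    then have "((\<lambda>t. L (a + of_real t * (b - a)) / (b - a)) has_vector_derivative L' u) (at t)"
      using has_vector_derivative_divide[of _ "(b - a) * L' u" "at t" "b - a"] ne by (simp add: o_def)
    then have "(G has_vector_derivative Re (L' u)) (at t)"
      unfolding G_def by (rule bounded_linear.has_vector_derivative[OF bounded_linear_Re])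
    then show "\<exists>y. DERIV G t :> y \<and> y > 0"
      using pos[OF u] by (auto simp: has_real_derivative_iff_has_vector_derivative)
  qed simp
  then show False
    by (simp add: G_def eq)
qed

text \<open>
  The logarithmic lift \<open>L(u) = u + k(exp u)\<close> of \<open>f\<close> to the left half plane is injective. It satisfies
  \<open>L(u + 2 \<pi> i n) = L(u) + 2 \<pi> i n\<close>, so equal values of \<open>f\<close> at nonzero points come from
  equal values of \<open>L\<close> at suitable logarithms of these points.
\<close>
lemma starlike_imp_univalent:
  assumes f: "f \<in> class_A" and zf: "zero_free f"
    and pos: "\<And>z. z \<in> unit_disc \<Longrightarrow> Re (sl_quot f z) > 0"
  shows "inj_on f unit_disc"
proof -
  define q where "q = nquot f (\<lambda>z. z)"
  have "q holomorphic_on unit_disc"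
    using nquot_id_holomorphic f by (simp add: q_def)
  moreover have qnz: "q z \<noteq> 0" if "z \<in> unit_disc" for z
    using zf that by (auto simp: q_def nquot_def zero_free_def)
  moreover have "contractible unit_disc"
    by (simp add: convex_imp_contractible)
  ultimately obtain k where k: "k holomorphic_on unit_disc"
    and qk: "\<And>z. z \<in> unit_disc \<Longrightarrow> q z = exp (k z)"
    using contractible_imp_holomorphic_log[of q unit_disc] by blast
  have fq: "f z = z * exp (k z)" if "z \<in> unit_disc" for z
    using qk[OF that] f
    by (cases "z = 0") (auto simp: q_def nquot_def class_A_def field_simps)
  have sl: "sl_quot f z = 1 + z * deriv k z" if z: "z \<in> unit_disc" for z
  proof -
    have "(k has_field_derivative deriv k z) (at z)"
      using k z holomorphic_derivI by blast
    then have "((\<lambda>z. exp (k z)) has_field_derivative exp (k z) * deriv k z) (at z)"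
      by (auto intro!: derivative_eq_intros)
    then have "deriv (\<lambda>z. exp (k z)) z = exp (k z) * deriv k z"
      by (rule DERIV_imp_deriv)
    then show ?thesis
      using sl_quot_product[OF z, of "\<lambda>z. exp (k z)" "\<lambda>_. 1" f] k fq
      by (auto intro!: holomorphic_intros)
  qed
  define H where "H = {u. Re u < 0}"
  define L where "L = (\<lambda>u. u + k (exp u))"
  have disc: "exp u \<in> unit_disc" if "u \<in> H" for u
    using that by (simp add: H_def)
  have injL: "inj_on L H"
  proof (rule inj_on_if_Re_deriv_pos)
    show "convex H"
      unfolding H_def by (rule convex_halfspace_Re_lt)
    fix u assume u: "u \<in> H"
    have "(k has_field_derivative deriv k (exp u)) (at (exp u))"
      using k disc[OF u] holomorphic_derivI by blast
    then have "((\<lambda>u. k (exp u)) has_field_derivative deriv k (exp u) * exp u) (at u)"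
      by (rule DERIV_chain2) (rule DERIV_exp)
    then have "(L has_field_derivative 1 + deriv k (exp u) * exp u) (at u)"
      unfolding L_def by (intro DERIV_add DERIV_ident)
    then show "(L has_field_derivative sl_quot f (exp u)) (at u)"
      using sl[OF disc[OF u]] by (simp add: mult.commute)
    show "Re (sl_quot f (exp u)) > 0"
      using pos disc[OF u] .
  qed
  show ?thesis
  proof (rule inj_onI)
    fix x y assume x: "x \<in> unit_disc" and y: "y \<in> unit_disc" and eq: "f x = f y"
    have f0: "f 0 = 0"
      using f by (simp add: class_A_def)
    show "x = y"
    proof (cases "x = 0 \<or> y = 0")
      case True
      then show ?thesis
        using zf x y eq f0 unfolding zero_free_def by (metis DiffI singletonD)
    next
      case False
      then have u: "Ln x \<in> H" and v: "Ln y \<in> H"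
        using x y by (auto simp: H_def)
      have "exp (L (Ln x)) = exp (L (Ln y))"
        using False eq fq x y by (simp add: L_def exp_add)
      then obtain n :: int where n: "L (Ln x) = L (Ln y) + of_real (2 * n * pi) * \<i>"
        by (auto simp: exp_eq mult.commute)
      \<comment> \<open>Shift the logarithm of \<open>y\<close> by the same period that separates the values of \<open>L\<close>.\<close>
      define v' where "v' = Ln y + of_real (2 * n * pi) * \<i>"
      have ev: "exp v' = y"
        using False by (simp add: v'_def exp_add exp_eq_1)
      have "v' \<in> H"
        using v by (simp add: v'_def H_def)
      moreover have "L (Ln x) = L v'"
        using n ev False by (simp add: L_def v'_def)
      ultimately have "Ln x = v'"
        using injL u by (meson inj_onD)
      then show ?thesis
        using ev False by (metis exp_Ln)
    qed
  qed
qed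

section \<open>From discs of values to radii\<close>

lemma dilation_class_A:
  assumes f: "f \<in> class_A" and r: "0 < r" "r \<le> 1"
  defines "F \<equiv> \<lambda>z. f (of_real r * z) / of_real r"
  shows "F \<in> class_A"
    and "zero_free f \<Longrightarrow> zero_free F"
    and "\<And>z. z \<in> unit_disc \<Longrightarrow> sl_quot F z = sl_quot f (of_real r * z)"
proof -
  have disc: "of_real r * z \<in> unit_disc" if "z \<in> unit_disc" for z :: complex
    using that r mult_le_one[of r "cmod z"] mult_right_le_one_le[of "cmod z" r]
    by (simp add: norm_mult mult.commute)
  have der: "(F has_field_derivative deriv f (of_real r * z)) (at z)" if "z \<in> unit_disc" for z
  proof -
    have "(f has_field_derivative deriv f (of_real r * z)) (at (of_real r * z))"
      using f disc[OF that] holomorphic_derivI[of f unit_disc] by (auto simp: class_A_def)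
    then have "((\<lambda>z. f (of_real r * z)) has_field_derivative deriv f (of_real r * z) * of_real r) (at z)"
      by (rule DERIV_chain2) (auto intro!: derivative_eq_intros)
    then show ?thesis
      unfolding F_def using DERIV_cdivide[of _ _ z UNIV "of_real r"] r by fastforce
  qed
  then have dF: "deriv F z = deriv f (of_real r * z)" if "z \<in> unit_disc" for z
    using that DERIV_imp_deriv by blast
  have "F holomorphic_on unit_disc"
    using der holomorphic_on_open[of unit_disc F] by blast
  then show "F \<in> class_A"
    using f dF[of 0] by (simp add: class_A_def F_def)
  show "zero_free F" if "zero_free f"
    using that disc r unfolding zero_free_def F_def by auto
  show "sl_quot F z = sl_quot f (of_real r * z)" if "z \<in> unit_disc" for z
    using dF[OF that] r by (simp add: sl_quot_def nquot_def F_def)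
qed

text \<open>
  The point at which \<open>(3 r + r\<^sup>2) / (1 - r\<^sup>2)\<close> reaches \<open>c\<close>: the positive root of
  \<open>(1 + c) r\<^sup>2 + 3 r - c\<close>, with the square root moved into the denominator.
\<close>
definition disc_radius :: "real \<Rightarrow> real" where
  "disc_radius c = 2 * c / (3 + sqrt (9 + 4 * (1 + c) * c))"

lemma disc_radius_equation:
  assumes c: "c > 0"
  shows "0 < disc_radius c" "disc_radius c < 1"
    and "3 * disc_radius c + (disc_radius c)\<^sup>2 = c * (1 - (disc_radius c)\<^sup>2)"
proof -
  define s where "s = sqrt (9 + 4 * (1 + c) * c)"
  define R where "R = disc_radius c"
  have s2: "s\<^sup>2 = 9 + 4 * (1 + c) * c" and s0: "s \<ge> 0"
    using c by (simp_all add: s_def)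
  have R: "R = 2 * c / (3 + s)"
    by (simp add: R_def disc_radius_def s_def)
  show pos: "0 < disc_radius c"
    using c s0 by (simp add: R[unfolded R_def])
  have "3 * R + R\<^sup>2 - c * (1 - R\<^sup>2) = (1 + c) * R\<^sup>2 + 3 * R - c"
    by (simp add: algebra_simps)
  also have "\<dots> = c * (9 + 4 * (1 + c) * c - s\<^sup>2) / (3 + s)\<^sup>2"
    unfolding R using s0 by (simp add: divide_simps) (simp add: power2_eq_square algebra_simps)
  finally show eq: "3 * disc_radius c + (disc_radius c)\<^sup>2 = c * (1 - (disc_radius c)\<^sup>2)"
    by (simp add: s2 R_def)
  then have "0 < c * (1 - (disc_radius c)\<^sup>2)"
    using pos by (smt (verit) zero_less_power)
  then have "(disc_radius c)\<^sup>2 < 1"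
    using c by (simp add: zero_less_mult_iff)
  then show "disc_radius c < 1"
    using pos by (simp add: abs_square_less_1)
qed

text \<open>
  On the open unit disc, the dilation by \<open>r\<close> evaluates \<open>z f'/f\<close> only at points of modulus below \<open>r\<close>,
  so the bound stays strictly below \<open>c\<close> even for \<open>r = disc_radius c\<close>.
\<close>
lemma admissible_disc_radius:
  assumes c: "c > 0"
    and G: "\<And>f. \<lbrakk>f \<in> class_A; zero_free f; \<And>z. z \<in> unit_disc \<Longrightarrow> cmod (sl_quot f z - 1) < c\<rbrakk> \<Longrightarrow> f \<in> \<G>"
  shows "admissible_radius \<G> class_F3 (disc_radius c)"
  unfolding admissible_radius_def
proof (intro conjI allI impI ballI)
  define R where "R = disc_radius c"
  note R = disc_radius_equation[OF c, folded R_def]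
  show "0 < disc_radius c" "disc_radius c \<le> 1"
    using R by (simp_all add: R_def)
  fix r f assume r: "0 < r \<and> r \<le> disc_radius c" and f: "f \<in> class_F3"
  have r1: "0 < r" "r \<le> 1"
    using r R by (simp_all add: R_def)
  have fA: "f \<in> class_A"
    using f by (simp add: class_F3_def)
  show "(\<lambda>z. f (of_real r * z) / of_real r) \<in> \<G>"
  proof (rule G)
    show "(\<lambda>z. f (of_real r * z) / of_real r) \<in> class_A"
      by (rule dilation_class_A(1)[OF fA r1])
    show "zero_free (\<lambda>z. f (of_real r * z) / of_real r)"
      by (rule dilation_class_A(2)[OF fA r1 class_F3_zero_free[OF f]])
    fix z assume z: "z \<in> unit_disc"
    define t where "t = cmod (of_real r * z)"
    have "t < r"
      using z r1 by (simp add: t_def norm_mult)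
    then have t: "0 \<le> t" "t < R" "t < 1"
      using r R(2) by (auto simp: t_def R_def)
    have t2: "t\<^sup>2 \<le> R\<^sup>2"
      using t by (simp add: power_mono)
    then have "3 * t + t\<^sup>2 < c * (1 - R\<^sup>2)"
      using t R(3) by linarith
    also have "\<dots> \<le> c * (1 - t\<^sup>2)"
      using t2 c by (intro mult_left_mono) auto
    finally have "(3 * t + t\<^sup>2) / (1 - t\<^sup>2) < c"
      using t by (simp add: divide_simps abs_square_less_1 power2_eq_1_iff)
    moreover have "cmod (sl_quot f (of_real r * z) - 1) \<le> (3 * t + t\<^sup>2) / (1 - t\<^sup>2)"
      unfolding t_def by (rule class_F3_sl_quot_bound[OF f]) (use t in \<open>simp add: t_def\<close>)
    ultimately show "cmod (sl_quot (\<lambda>z. f (of_real r * z) / of_real r) z - 1) < c"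
      using dilation_class_A(3)[OF fA r1 z] by simp
  qed
qed

text \<open>
  The choice \<open>p(z) = (1 + z)/(1 - z)\<close>, \<open>h(z) = 1 + z\<close> in the factorization. At \<open>z = -r\<close> both
  logarithmic derivatives are real and positive and attain their bounds, so that the two
  contributions to \<open>z f'/f - 1\<close> are negative and add up.
\<close>
definition extremal_F3 :: "complex \<Rightarrow> complex" where
  "extremal_F3 z = z * ((1 + z) / (1 - z)) * (1 + z)"

lemma class_A_times_z:
  assumes "q holomorphic_on unit_disc" "q 0 = 1"
  shows "(\<lambda>z. z * q z) \<in> class_A"
proof -
  have "(q has_field_derivative deriv q 0) (at 0)"
    using assms holomorphic_derivI[of q unit_disc] by auto
  then have "((\<lambda>z. z * q z) has_field_derivative 1) (at 0)"
    using assms by (auto intro!: derivative_eq_intros)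
  then show ?thesis
    using assms by (auto simp: class_A_def DERIV_imp_deriv intro!: holomorphic_intros)
qed

lemma extremal_F3_attains:
  shows "extremal_F3 \<in> class_F3"
    and "0 < r \<Longrightarrow> r < 1 \<Longrightarrow>
      sl_quot extremal_F3 (- of_real r) = of_real (1 - (3 * r + r\<^sup>2) / (1 - r\<^sup>2))"
proof -
  define p :: "complex \<Rightarrow> complex" where "p = (\<lambda>z. (1 + z) / (1 - z))"
  have nz: "1 - z \<noteq> 0" "1 + z \<noteq> 0" if "z \<in> unit_disc" for z :: complex
    using that by (auto simp: add_eq_0_iff)
  have p: "p holomorphic_on unit_disc"
    unfolding p_def using nz by (intro holomorphic_intros)
  have h: "(\<lambda>z::complex. 1 + z) holomorphic_on unit_disc"
    by (intro holomorphic_intros)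
  have f: "extremal_F3 = (\<lambda>z. z * (p z * (1 + z)))"
    by (simp add: extremal_F3_def p_def fun_eq_iff mult.assoc)
  have fA: "extremal_F3 \<in> class_A"
    unfolding f by (rule class_A_times_z) (auto intro!: holomorphic_intros p simp: p_def)
  have gA: "(\<lambda>z. z * p z) \<in> class_A"
    by (rule class_A_times_z[OF p]) (simp add: p_def)
  have "Re (p z) > 0" if "z \<in> unit_disc" for z
  proof -
    have "(Re z)\<^sup>2 + (Im z)\<^sup>2 < 1"
      using that by (simp add: cmod_def)
    moreover have "Re (p z) = (1 - (Re z)\<^sup>2 - (Im z)\<^sup>2) / (cmod (1 - z))\<^sup>2"
      unfolding p_def Re_divide' by (simp add: power2_eq_square algebra_simps)
    ultimately show ?thesis
      using nz[OF that] by simp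
  qed
  then have "Re (nquot (\<lambda>z. z * p z) (\<lambda>z. z) z) > 0" if "z \<in> unit_disc" for z
    using that by (simp add: nquot_def)
  moreover have "cmod (nquot extremal_F3 (\<lambda>z. z * p z) z - 1) < 1" if "z \<in> unit_disc" for z
    using that nz[OF that] by (simp add: nquot_def f p_def)
  ultimately show "extremal_F3 \<in> class_F3"
    unfolding class_F3_def using fA gA by blast
  show "sl_quot extremal_F3 (- of_real r) = of_real (1 - (3 * r + r\<^sup>2) / (1 - r\<^sup>2))"
    if r: "0 < r" "r < 1"
  proof -
    define z :: complex where "z = - of_real r"
    have z: "z \<in> unit_disc"
      using r by (simp add: z_def)
    have "(p has_field_derivative 2 / (1 - z)\<^sup>2) (at z)"
      unfolding p_def using nz[OF z]
      by (auto intro!: derivative_eq_intros simp: power2_eq_square)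
    then have dp: "deriv p z = 2 / (1 - z)\<^sup>2"
      by (rule DERIV_imp_deriv)
    have dh: "deriv (\<lambda>z. 1 + z) z = 1"
      by (intro DERIV_imp_deriv) (auto intro!: derivative_eq_intros)
    have "sl_quot extremal_F3 z = 1 + z * (deriv p z / p z) + z * (deriv (\<lambda>z. 1 + z) z / (1 + z))"
      by (rule sl_quot_product[OF z p h]) (use nz[OF z] in \<open>simp_all add: p_def f\<close>)
    also have "\<dots> = 1 + 2 * z / ((1 - z) * (1 + z)) + z / (1 + z)"
      unfolding dp dh using nz[OF z]
      by (simp add: p_def divide_simps) (simp add: power2_eq_square algebra_simps)
    also have "\<dots> = of_real (1 - 2 * r / ((1 + r) * (1 - r)) - r / (1 - r))"
      by (simp add: z_def)
    also have "1 - 2 * r / ((1 + r) * (1 - r)) - r / (1 - r) = 1 - (3 * r + r\<^sup>2) / (1 - r\<^sup>2)"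
    proof -
      have "1 - r\<^sup>2 = (1 + r) * (1 - r)"
        by (simp add: power2_eq_square algebra_simps)
      then show ?thesis
        using r by (simp add: divide_simps) (simp add: power2_eq_square algebra_simps)
    qed
    finally show ?thesis
      by (simp add: z_def)
  qed
qed

text \<open>
  Dilating the extremal function by some \<open>R' > disc_radius c\<close> brings the point
  \<open>-disc_radius c\<close>, where \<open>z f'/f = 1 - c\<close>, into the unit disc.
\<close>
lemma disc_radius_sharp:
  assumes c: "c > 0"
    and G: "\<And>f z. \<lbrakk>f \<in> \<G>; z \<in> unit_disc\<rbrakk> \<Longrightarrow> sl_quot f z \<noteq> of_real (1 - c)"
    and adm: "admissible_radius \<G> class_F3 R'"
  shows "R' \<le> disc_radius c"
proof (rule ccontr)
  define R where "R = disc_radius c"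
  note R = disc_radius_equation[OF c, folded R_def]
  assume "\<not> R' \<le> disc_radius c"
  then have lt: "R < R'"
    by (simp add: R_def)
  have R': "0 < R'" "R' \<le> 1"
    using adm by (auto simp: admissible_radius_def)
  define F where "F = (\<lambda>z. extremal_F3 (of_real R' * z) / of_real R')"
  have FG: "F \<in> \<G>"
    using adm extremal_F3_attains(1) unfolding admissible_radius_def F_def by blast
  define z :: complex where "z = - of_real (R / R')"
  have z: "z \<in> unit_disc"
    using lt R(1) R' by (simp add: z_def norm_divide)
  have A: "extremal_F3 \<in> class_A"
    using extremal_F3_attains(1) by (simp add: class_F3_def)
  have "sl_quot F z = sl_quot extremal_F3 (of_real R' * z)"
    unfolding F_def by (rule dilation_class_A(3)[OF A R' z])
  also have "of_real R' * z = - of_real R"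
    using R' by (simp add: z_def)
  also have "sl_quot extremal_F3 (- of_real R) = of_real (1 - (3 * R + R\<^sup>2) / (1 - R\<^sup>2))"
    using extremal_F3_attains(2) R by blast
  also have "(3 * R + R\<^sup>2) / (1 - R\<^sup>2) = c"
    using R by (simp add: divide_simps power2_eq_1_iff)
  finally show False
    using G[OF FG z] by simp
qed

section \<open>The four radii\<close>

text \<open>
  If \<open>|w - 1| < \<surd>2 - 1\<close>, then \<open>|w + 1| < \<surd>2 + 1\<close>, and the product of the two bounds is 1.
\<close>
lemma lemniscate_radius: "admissible_radius lemniscate_starlike class_F3 (disc_radius (sqrt 2 - 1))"
proof (rule admissible_disc_radius)
  fix f assume f: "f \<in> class_A" "zero_free f"
    and near: "\<And>z. z \<in> unit_disc \<Longrightarrow> cmod (sl_quot f z - 1) < sqrt 2 - 1"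
  have "cmod ((sl_quot f z)\<^sup>2 - 1) < 1" if "z \<in> unit_disc" for z
  proof -
    define w where "w = sl_quot f z"
    have w: "cmod (w - 1) < sqrt 2 - 1"
      using near[OF that] by (simp add: w_def)
    have "cmod (w + 1) \<le> cmod (w - 1) + 2"
      using norm_triangle_ineq[of "w - 1" 2] by (simp add: add.commute)
    then have "cmod (w + 1) < sqrt 2 + 1"
      using w by linarith
    then have "cmod (w - 1) * cmod (w + 1) < (sqrt 2 - 1) * (sqrt 2 + 1)"
      using w by (intro mult_strict_mono') auto
    also have "\<dots> = 1"
      by (simp add: algebra_simps)
    finally show ?thesis
      by (simp add: w_def power2_eq_square algebra_simps flip: norm_mult)
  qed
  then show "f \<in> lemniscate_starlike"
    using f by (simp add: lemniscate_starlike_def)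
qed simp

lemma class_M_radius:
  assumes "\<beta> > 1"
  shows "admissible_radius (class_M \<beta>) class_F3 (disc_radius (\<beta> - 1))"
proof (rule admissible_disc_radius)
  fix f assume f: "f \<in> class_A" "zero_free f"
    and near: "\<And>z. z \<in> unit_disc \<Longrightarrow> cmod (sl_quot f z - 1) < \<beta> - 1"
  have "Re (sl_quot f z) < \<beta>" if "z \<in> unit_disc" for z
    using near[OF that] complex_Re_le_cmod[of "sl_quot f z - 1"] by simp
  then show "f \<in> class_M \<beta>"
    using f by (simp add: class_M_def)
qed (use assms in simp)

text \<open>
  A disc of radius \<open>1 - \<alpha>\<close> around 1 touches the line \<open>Re w = \<alpha>\<close> in \<open>\<alpha> = 1 - c\<close>, the value that the
  extremal function takes.
\<close>
lemma starlike_order_radius: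
  assumes \<alpha>: "0 \<le> \<alpha>" "\<alpha> < 1"
  shows "is_radius (starlike_order \<alpha>) class_F3 (disc_radius (1 - \<alpha>))"
  unfolding is_radius_def
proof (intro conjI allI impI)
  show "admissible_radius (starlike_order \<alpha>) class_F3 (disc_radius (1 - \<alpha>))"
  proof (rule admissible_disc_radius)
    fix f assume f: "f \<in> class_A" "zero_free f"
      and near: "\<And>z. z \<in> unit_disc \<Longrightarrow> cmod (sl_quot f z - 1) < 1 - \<alpha>"
    have gt: "Re (sl_quot f z) > \<alpha>" if "z \<in> unit_disc" for z
      using near[OF that] abs_Re_le_cmod[of "sl_quot f z - 1"] by simp
    have "inj_on f unit_disc"
      using gt \<alpha> by (intro starlike_imp_univalent f) (meson le_less_trans)
    then show "f \<in> starlike_order \<alpha>"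
      using f gt by (simp add: starlike_order_def class_S_def)
  qed (use \<alpha> in simp)
  show "R' \<le> disc_radius (1 - \<alpha>)" if "admissible_radius (starlike_order \<alpha>) class_F3 R'" for R'
    by (rule disc_radius_sharp[OF _ _ that]) (use \<alpha> in \<open>force simp: starlike_order_def\<close>)+
qed

text \<open>
  The disc of radius \<open>1/2\<close> around 1 touches the parabola \<open>Re w = |w - 1|\<close> in its vertex
  \<open>1/2 = 1 - c\<close>.
\<close>
lemma parabolic_radius: "is_radius parabolic_starlike class_F3 (disc_radius (1 / 2))"
  unfolding is_radius_def
proof (intro conjI allI impI)
  show "admissible_radius parabolic_starlike class_F3 (disc_radius (1 / 2))"
  proof (rule admissible_disc_radius)
    fix f assume f: "f \<in> class_A" "zero_free f"
      and near: "\<And>z. z \<in> unit_disc \<Longrightarrow> cmod (sl_quot f z - 1) < 1 / 2"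
    have "Re (sl_quot f z) > cmod (sl_quot f z - 1)" if "z \<in> unit_disc" for z
      using near[OF that] abs_Re_le_cmod[of "sl_quot f z - 1"] by simp
    then show "f \<in> parabolic_starlike"
      using f by (simp add: parabolic_starlike_def)
  qed simp
  have ne: "sl_quot f z \<noteq> of_real (1 - 1 / 2)" if "f \<in> parabolic_starlike" "z \<in> unit_disc" for f z
  proof
    assume eq: "sl_quot f z = of_real (1 - 1 / 2)"
    have "cmod (sl_quot f z - 1) = 1 / 2" "Re (sl_quot f z) = 1 / 2"
      unfolding eq by (simp_all add: cmod_def power2_eq_square real_sqrt_divide)
    then show False
      using that by (force simp: parabolic_starlike_def)
  qed
  show "R' \<le> disc_radius (1 / 2)" if "admissible_radius parabolic_starlike class_F3 R'" for R'
    by (rule disc_radius_sharp[OF _ ne that]) auto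
qed

lemma disc_radius_lemniscate:
  "disc_radius (sqrt 2 - 1) = (4 - 2 * sqrt 2) / (sqrt 2 * (sqrt (17 - 4 * sqrt 2) + 3))"
proof -
  have "9 + 4 * (1 + (sqrt 2 - 1)) * (sqrt 2 - 1) = 17 - 4 * sqrt 2"
    by (simp add: algebra_simps)
  moreover have "4 - 2 * sqrt 2 = sqrt 2 * (2 * (sqrt 2 - 1))"
    by (simp add: algebra_simps)
  moreover have "sqrt 2 * a / (sqrt 2 * b) = a / b" for a b :: real
    by simp
  ultimately show ?thesis
    unfolding disc_radius_def by (simp only: add.commute)
qed

lemma disc_radius_half: "disc_radius (1 / 2) = (2 * sqrt 3 - 3) / 3"
proof -
  have "sqrt 12 = 2 * sqrt (3::real)"
    using real_sqrt_mult[of 4 3] by simp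
  moreover have "3 + 2 * sqrt 3 > (0::real)"
    by (simp add: add_pos_nonneg)
  ultimately show ?thesis
    by (simp add: disc_radius_def field_simps)
qed

lemma lemniscate_radius_approx:
  "\<bar>(4 - 2 * sqrt 2) / (sqrt 2 * (sqrt (17 - 4 * sqrt 2) + 3)) - 0.13009\<bar> < (0.000005::real)"
proof -
  have s: "1.414213 < sqrt 2" "sqrt 2 < (1.414214::real)"
    by (rule real_less_rsqrt real_less_lsqrt; simp add: power2_eq_square)+
  define t where "t = sqrt (17 - 4 * sqrt 2)"
  have t: "3.36795 < t" "t < 3.36797"
    unfolding t_def using s
    by (intro real_less_rsqrt real_less_lsqrt; simp add: power2_eq_square)+
  have "disc_radius (sqrt 2 - 1) = 2 * (sqrt 2 - 1) / (3 + t)"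
    by (simp add: disc_radius_def t_def algebra_simps)
  moreover have "\<bar>2 * (sqrt 2 - 1) / (3 + t) - 0.13009\<bar> < 0.000005"
    using s t by (simp add: abs_less_iff field_simps)
  ultimately show ?thesis
    by (simp add: disc_radius_lemniscate)
qed

lemma parabolic_radius_approx: "\<bar>(2 * sqrt 3 - 3) / 3 - 0.154701\<bar> < (0.0000005::real)"
proof -
  have "1.7320508 < sqrt 3" "sqrt 3 < (1.7320509::real)"
    by (rule real_less_rsqrt real_less_lsqrt; simp add: power2_eq_square)+
  then show ?thesis
    by (simp add: abs_less_iff field_simps)
qed

theorem theorem2p3:
  "(let R = (4 - 2 * sqrt 2) / (sqrt 2 * (sqrt (17 - 4 * sqrt 2) + 3)) in
      admissible_radius lemniscate_starlike class_F3 R \<and> \<bar>R - 0.13009\<bar> < 0.000005) \<and>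
   (\<forall>\<beta>::real. 1 < \<beta> \<longrightarrow>
      admissible_radius (class_M \<beta>) class_F3
        (2 * (\<beta> - 1) / (3 + sqrt (9 + 4 * \<beta> * (\<beta> - 1))))) \<and>
   (\<forall>\<alpha>::real. 0 \<le> \<alpha> \<and> \<alpha> < 1 \<longrightarrow>
      is_radius (starlike_order \<alpha>) class_F3
        (2 * (1 - \<alpha>) / (3 + sqrt (9 + 4 * (2 - \<alpha>) * (1 - \<alpha>))))) \<and>
   (let R = (2 * sqrt 3 - 3) / 3 in
      is_radius parabolic_starlike class_F3 R \<and>
      is_radius (starlike_order (1/2)) class_F3 R \<and>
      \<bar>R - 0.154701\<bar> < 0.0000005)"
proof -
  have "2 * (\<beta> - 1) / (3 + sqrt (9 + 4 * \<beta> * (\<beta> - 1))) = disc_radius (\<beta> - 1)" for \<beta>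
    by (simp add: disc_radius_def)
  moreover have "2 * (1 - \<alpha>) / (3 + sqrt (9 + 4 * (2 - \<alpha>) * (1 - \<alpha>))) = disc_radius (1 - \<alpha>)" for \<alpha>
    by (simp add: disc_radius_def)
  moreover have "is_radius (starlike_order (1/2)) class_F3 (disc_radius (1/2))"
    using starlike_order_radius[of "1/2"] by simp
  ultimately show ?thesis
    unfolding Let_def
    using lemniscate_radius lemniscate_radius_approx class_M_radius starlike_order_radius
      parabolic_radius parabolic_radius_approx
    by (simp only: disc_radius_lemniscate disc_radius_half) blast
qed

end
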